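(* Let $\mathcal{A}^\star$ be the mod 2 motivic Steenrod algebra over a base scheme with no points of residue characteristic two, let $\operatorname{Sq}^{i}$ be the motivic Steenrod squares, let $Q_i\in\mathcal{A}^\star$ ($i\ge 0$) be the element of the Milnor basis dual to $\tau_i$, put $Q_{-1}:=0$, and let $\rho\in H^{1,1}$ be the class of $-1$. Then the Milnor primitives $Q_n$ are generated, starting from $Q_0=\operatorname{Sq}^1$, by the recursive formula \[ Q_{n+1} = [Q_n, \operatorname{Sq}^{2^{n+1}}] + \rho\, Q_n \operatorname{Sq}^{2^n} Q_{n-1},\qquad n\ge 0, \] where $[A,B]:=AB-BA$.
   Context: Base: a base scheme $S$ with no points of residue characteristic two (for instance $S=\operatorname{Spec} k$, $k$ a field with $\operatorname{char} k\neq 2$, or an essentially smooth scheme over such a field). $H^\star=H^{\star}(S;\mathbb{Z}/2)$ is the bigraded mod 2 motivic cohomology of the base, and $H_\star:=H^{-\star}$. $\tau$ is the generator of $H^{0,1}$ (over a field $H^{0,1}\cong\mu_2(k)$), and $\rho\in H^{1,1}$ is the class of $-1$ (over a field $H^{1,1}\cong k^\times/(k^\times)^2$). The mod 2 motivic Steenrod algebra $\mathcal{A}^\star$ is the $H^\star$-algebra of bistable operations on mod 2 motivic cohomology; it is generated over $H^\star$ by the motivic Steenrod squares $\operatorname{Sq}^i$ ($\operatorname{Sq}^0=1$, $\operatorname{Sq}^1$ the Bockstein), and is a free left $H^\star$-module on the admissible monomials in the $\operatorname{Sq}^i$. Its dual is $\mathcal{A}_\star:=\operatorname{Hom}(\mathcal{A}^\star,H^\star)$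 (left $H^\star$-linear maps), and \[ \mathcal{A}_\star \cong H_\star[\tau_0,\tau_1,\ldots,\xi_1,\xi_2,\ldots]\big/\big(\tau_i^2+\tau\xi_{i+1}+\rho(\tau_{i+1}+\tau_0\xi_{i+1}),\ i\ge 0\big), \] with $|\tau_i|=(2^{i+1}-1,2^i-1)$ and $|\xi_i|=(2^{i+1}-2,2^i-1)$. It is a Hopf algebroid with $\eta_L(x)=\eta_R(x)=x$ for $x\in H^{1,1}=H_{-1,-1}$, $\eta_L\tau=\tau$, $\eta_R\tau=\tau+\rho\tau_0$, $\epsilon\tau_i=0$ for $i\geq 0$, $\epsilon\xi_i=0$ for $i\geq 1$, $\Delta x = x\otimes 1$ for $x\in H_\star$, and, with $\xi_0=1$, \[ \Delta\xi_k=\sum_{i=0}^k\xi_{k-i}^{2^i}\otimes\xi_i,\qquad \Delta\tau_k=\tau_k\otimes 1+\sum_{i=0}^k\xi_{k-i}^{2^i}\otimes\tau_i . \] Here $\Delta:\mathcal{A}_\star\to\mathcal{A}_\star\otimes_{r,l}\mathcal{A}_\star$, the tensor product using the right module structure (via $\eta_R$) on the first factor and the left one (via $\eta_L$) on the second. With $\langle\alpha,\theta\rangle:=\alpha(\theta)\in H^\star$, the product of $\mathcal{A}^\star$ is related to $\Delta$ by $\langle\alpha,\theta_1\theta_2\rangle=[\Delta\alpha,\theta_1\otimes\theta_2]$, where $[\alpha_1\otimes\alpha_2,\theta_1\otimes\theta_2]:=\langle\alpha_1,\theta_1\langle\alpha_2,\theta_2\rangle\rangle$ (this pairing bracket is not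 the commutator). $\mathcal{A}_\star$ is a free left $H_\star$-module on the monomials $\tau(E)\xi(R)=\prod_i\tau_i^{\epsilon_i}\prod_i\xi_i^{r_i}$, where $E=(\epsilon_0,\epsilon_1,\dots)$ with $\epsilon_i\in\{0,1\}$ and $R=(r_1,r_2,\dots)$ with $r_i\ge0$ are finite sequences. The dual basis $\{\widehat{\tau(E)\xi(R)}\}$ of $\mathcal{A}^\star$ is called the Milnor basis. Set $Q_i:=\widehat{\tau_i}$ and $\mathcal{P}^R:=\widehat{\xi(R)}$. Known facts: $Q_0=\operatorname{Sq}^1$, $\operatorname{Sq}^{2m}=\widehat{\xi_1^m}$, $\widehat{\tau(E)\xi(R)}=\big(\prod_i Q_i^{\epsilon_i}\big)\mathcal{P}^R$, $Q_iQ_j=Q_jQ_i$ and $Q_i^2=0$. *)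

theory Defs
  imports Complex_Main "HOL-Library.Multiset" "HOL-Library.Poly_Mapping" "HOL-Library.Product_Plus"
begin

section \<open>Algebraic vocabulary\<close>

definition unital_ring_hom :: "('r::ring_1 \<Rightarrow> 's::ring_1) \<Rightarrow> bool" where
  "unital_ring_hom f \<longleftrightarrow>
     f 1 = 1 \<and> (\<forall>x y. f (x + y) = f x + f y) \<and> (\<forall>x y. f (x * y) = f x * f y)"

definition commutator :: "'r::ring \<Rightarrow> 'r \<Rightarrow> 'r" where
  "commutator a b = a * b - b * a"

definition bigraded_ring :: "(int \<times> int \<Rightarrow> 'r::ring_1 set) \<Rightarrow> bool" where
  "bigraded_ring G \<longleftrightarrow>
     (\<forall>d. 0 \<in> G d \<and> (\<forall>x\<in>G d. \<forall>y\<in>G d. x - y \<in> G d)) \<and>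
     1 \<in> G 0 \<and>
     (\<forall>d e. \<forall>x\<in>G d. \<forall>y\<in>G e. x * y \<in> G (d + e)) \<and>
     (\<forall>x. \<exists>!c. (\<forall>d. c d \<in> G d) \<and> finite {d. c d \<noteq> 0} \<and> x = (\<Sum>d | c d \<noteq> 0. c d))"

definition module_basis ::
    "('h::comm_ring_1 \<Rightarrow> 'm::ab_group_add \<Rightarrow> 'm) \<Rightarrow> 'i set \<Rightarrow> ('i \<Rightarrow> 'm) \<Rightarrow> bool" where
  "module_basis scale I b \<longleftrightarrow>
     module scale \<and> inj_on b I \<and>
     \<not> module.dependent scale (b ` I) \<and> module.span scale (b ` I) = UNIV"

section \<open>Tensor products of bimodules\<close>

text \<open>
  Let a ring \<open>D\<close> be a bimodule over \<open>H\<close> through \<open>l\<close> (left) and \<open>r\<close> (right). An element of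
  \<open>D \<otimes>\<^bsub>r,l\<^esub> D\<close> is represented by a multiset of pairs \<open>(a, b)\<close>, standing for the sum of the
  pure tensors \<open>a \<otimes> b\<close>. Two multisets represent the same tensor iff they are related by the
  following congruence. The quotient of the free commutative monoid by it is already a group,
  because \<open>(a, b)\<close> and \<open>(- a, b)\<close> add up to zero.
\<close>

inductive tensor_eq ::
    "('h::comm_ring_1 \<Rightarrow> 'd::comm_ring_1) \<Rightarrow> ('h \<Rightarrow> 'd) \<Rightarrow>
     ('d \<times> 'd) multiset \<Rightarrow> ('d \<times> 'd) multiset \<Rightarrow> bool" for l r where
  te_refl: "tensor_eq l r u u"
| te_sym: "tensor_eq l r u v \<Longrightarrow> tensor_eq l r v u"
| te_trans: "tensor_eq l r u v \<Longrightarrow> tensor_eq l r v w \<Longrightarrow> tensor_eq l r u w"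
| te_plus: "tensor_eq l r u v \<Longrightarrow> tensor_eq l r u' v' \<Longrightarrow> tensor_eq l r (u + u') (v + v')"
| te_zero: "tensor_eq l r {#(0, b)#} {#}"
| te_add1: "tensor_eq l r {#(a + a', b)#} {#(a, b), (a', b)#}"
| te_add2: "tensor_eq l r {#(a, b + b')#} {#(a, b), (a, b')#}"
| te_balance: "tensor_eq l r {#(a * r h, b)#} {#(a, l h * b)#}"

inductive tensor3_eq ::
    "('h::comm_ring_1 \<Rightarrow> 'd::comm_ring_1) \<Rightarrow> ('h \<Rightarrow> 'd) \<Rightarrow>
     ('d \<times> 'd \<times> 'd) multiset \<Rightarrow> ('d \<times> 'd \<times> 'd) multiset \<Rightarrow> bool" for l r where
  te3_refl: "tensor3_eq l r u u"
| te3_sym: "tensor3_eq l r u v \<Longrightarrow> tensor3_eq l r v u"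
| te3_trans: "tensor3_eq l r u v \<Longrightarrow> tensor3_eq l r v w \<Longrightarrow> tensor3_eq l r u w"
| te3_plus: "tensor3_eq l r u v \<Longrightarrow> tensor3_eq l r u' v' \<Longrightarrow> tensor3_eq l r (u + u') (v + v')"
| te3_zero: "tensor3_eq l r {#(0, b, c)#} {#}"
| te3_add1: "tensor3_eq l r {#(a + a', b, c)#} {#(a, b, c), (a', b, c)#}"
| te3_add2: "tensor3_eq l r {#(a, b + b', c)#} {#(a, b, c), (a, b', c)#}"
| te3_add3: "tensor3_eq l r {#(a, b, c + c')#} {#(a, b, c), (a, b, c')#}"
| te3_balance1: "tensor3_eq l r {#(a * r h, b, c)#} {#(a, l h * b, c)#}"
| te3_balance2: "tensor3_eq l r {#(a, b * r h, c)#} {#(a, b, l h * c)#}"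

definition tensor_mult ::
    "('d::comm_ring_1 \<times> 'd) multiset \<Rightarrow> ('d \<times> 'd) multiset \<Rightarrow> ('d \<times> 'd) multiset" where
  "tensor_mult u v = (\<Sum>(a, b)\<in>#u. \<Sum>(a', b')\<in>#v. {#(a * a', b * b')#})"

section \<open>Commutative Hopf algebroids\<close>

text \<open>
  The coproduct \<open>\<Delta>\<close> picks a representing multiset; every statement about it is modulo
  \<open>tensor_eq\<close>, or goes through a biadditive balanced map.
\<close>

locale hopf_algebroid =
  fixes \<eta>\<^sub>L \<eta>\<^sub>R :: "'h::comm_ring_1 \<Rightarrow> 'd::comm_ring_1"
    and \<epsilon> :: "'d \<Rightarrow> 'h"
    and \<Delta> :: "'d \<Rightarrow> ('d \<times> 'd) multiset"
    and antipode :: "'d \<Rightarrow> 'd"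
  assumes eta_L_hom: "unital_ring_hom \<eta>\<^sub>L"
    and eta_R_hom: "unital_ring_hom \<eta>\<^sub>R"
    and counit_hom: "unital_ring_hom \<epsilon>"
    and antipode_hom: "unital_ring_hom antipode"
    and coprod_one: "tensor_eq \<eta>\<^sub>L \<eta>\<^sub>R (\<Delta> 1) {#(1, 1)#}"
    and coprod_add: "tensor_eq \<eta>\<^sub>L \<eta>\<^sub>R (\<Delta> (x + y)) (\<Delta> x + \<Delta> y)"
    and coprod_mult: "tensor_eq \<eta>\<^sub>L \<eta>\<^sub>R (\<Delta> (x * y)) (tensor_mult (\<Delta> x) (\<Delta> y))"
    and coprod_eta_L: "tensor_eq \<eta>\<^sub>L \<eta>\<^sub>R (\<Delta> (\<eta>\<^sub>L h)) {#(\<eta>\<^sub>L h, 1)#}"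
    and coprod_eta_R: "tensor_eq \<eta>\<^sub>L \<eta>\<^sub>R (\<Delta> (\<eta>\<^sub>R h)) {#(1, \<eta>\<^sub>R h)#}"
    and counit_eta_L: "\<epsilon> (\<eta>\<^sub>L h) = h"
    and counit_eta_R: "\<epsilon> (\<eta>\<^sub>R h) = h"
    and counit_left: "(\<Sum>(a, b)\<in>#\<Delta> x. \<eta>\<^sub>L (\<epsilon> a) * b) = x"
    and counit_right: "(\<Sum>(a, b)\<in>#\<Delta> x. a * \<eta>\<^sub>R (\<epsilon> b)) = x"
    and coassoc: "tensor3_eq \<eta>\<^sub>L \<eta>\<^sub>R
          (\<Sum>(a, b)\<in>#\<Delta> x. \<Sum>(a1, a2)\<in>#\<Delta> a. {#(a1, a2, b)#})
          (\<Sum>(a, b)\<in>#\<Delta> x. \<Sum>(b1, b2)\<in>#\<Delta> b. {#(a, b1, b2)#})"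
    and antipode_eta_L: "antipode (\<eta>\<^sub>L h) = \<eta>\<^sub>R h"
    and antipode_eta_R: "antipode (\<eta>\<^sub>R h) = \<eta>\<^sub>L h"
    and antipode_antipode: "antipode (antipode x) = x"
    and antipode_left: "(\<Sum>(a, b)\<in>#\<Delta> x. antipode a * b) = \<eta>\<^sub>R (\<epsilon> x)"
    and antipode_right: "(\<Sum>(a, b)\<in>#\<Delta> x. a * antipode b) = \<eta>\<^sub>L (\<epsilon> x)"

section \<open>The presentation of the dual Steenrod algebra\<close>

text \<open>
  Polynomials over \<open>H\<close> in the variables \<open>\<tau>\<^sub>0, \<tau>\<^sub>1, \<dots>, \<xi>\<^sub>1, \<xi>\<^sub>2, \<dots>\<close> are finitely supported functions
  on exponent vectors. The variable \<open>Xi i\<close> stands for \<open>\<xi>\<close> with index \<open>Suc i\<close>.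
\<close>

datatype milnor_var = Tau nat | Xi nat

type_synonym 'h milnor_poly = "(milnor_var \<Rightarrow>\<^sub>0 nat) \<Rightarrow>\<^sub>0 'h"

definition pvar :: "milnor_var \<Rightarrow> 'h::comm_ring_1 milnor_poly" where
  "pvar v = Poly_Mapping.single (Poly_Mapping.single v 1) 1"

definition pconst :: "'h::comm_ring_1 \<Rightarrow> 'h milnor_poly" where
  "pconst h = Poly_Mapping.single 0 h"

fun milnor_gen :: "(nat \<Rightarrow> 'd) \<Rightarrow> (nat \<Rightarrow> 'd) \<Rightarrow> milnor_var \<Rightarrow> 'd" where
  "milnor_gen t x (Tau i) = t i"
| "milnor_gen t x (Xi i) = x (Suc i)"

definition peval ::
    "('h::comm_ring_1 \<Rightarrow> 'd::comm_ring_1) \<Rightarrow> (milnor_var \<Rightarrow> 'd) \<Rightarrow> 'h milnor_poly \<Rightarrow> 'd" where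
  "peval \<eta> g p =
     (\<Sum>m\<in>Poly_Mapping.keys p.
        \<eta> (Poly_Mapping.lookup p m) * (\<Prod>v\<in>Poly_Mapping.keys m. g v ^ Poly_Mapping.lookup m v))"

definition milnor_rel :: "'h::comm_ring_1 \<Rightarrow> 'h \<Rightarrow> nat \<Rightarrow> 'h milnor_poly" where
  "milnor_rel \<tau> \<rho> i =
     pvar (Tau i) ^ 2 + pconst \<tau> * pvar (Xi i)
       + pconst \<rho> * (pvar (Tau (Suc i)) + pvar (Tau 0) * pvar (Xi i))"

section \<open>Monomials\<close>

text \<open>
  Indices \<open>(E, R)\<close> of the monomials \<open>\<tau>(E) \<xi>(R)\<close>. The sequence \<open>R\<close> starts at index 1, which is
  encoded by \<open>R 0 = 0\<close>.
\<close>

type_synonym milnor_index = "(nat \<Rightarrow> nat) \<times> (nat \<Rightarrow> nat)"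

definition milnor_indices :: "milnor_index set" where
  "milnor_indices =
     {(E, R). finite {i. E i \<noteq> 0} \<and> (\<forall>i. E i \<in> {0, 1}) \<and> finite {i. R i \<noteq> 0} \<and> R 0 = 0}"

definition milnor_monomial ::
    "(nat \<Rightarrow> 'd::comm_ring_1) \<Rightarrow> (nat \<Rightarrow> 'd) \<Rightarrow> milnor_index \<Rightarrow> 'd" where
  "milnor_monomial t x = (\<lambda>(E, R).
     (\<Prod>i | E i \<noteq> 0. t i ^ E i) * (\<Prod>i | R i \<noteq> 0. x i ^ R i))"

definition tau_index :: "nat \<Rightarrow> milnor_index" where
  "tau_index n = ((\<lambda>_. 0)(n := 1), \<lambda>_. 0)"

definition xi1_index :: "nat \<Rightarrow> milnor_index" where
  "xi1_index m = (\<lambda>_. 0, (\<lambda>_. 0)(1 := m))"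

text \<open>The Milnor primitives, with \<open>Q\<close> zero in negative degrees, from the Milnor basis \<open>hat\<close>.\<close>

definition milnor_Q :: "(milnor_index \<Rightarrow> 'a::zero) \<Rightarrow> int \<Rightarrow> 'a" where
  "milnor_Q hat n = (if n < 0 then 0 else hat (tau_index (nat n)))"

definition admissible :: "nat list \<Rightarrow> bool" where
  "admissible is \<longleftrightarrow>
     0 \<notin> set is \<and> (\<forall>j. Suc j < length is \<longrightarrow> is ! j \<ge> 2 * is ! Suc j)"

section \<open>Functionals on the Steenrod algebra\<close>

text \<open>
  With \<open>\<iota>\<close> the inclusion of \<open>H\<close> in \<open>A\<close>. A functional of (homological) bidegree \<open>d\<close>
  lowers cohomological bidegrees by \<open>d\<close>.
\<close>

definition homogeneous_functional ::
    "(int \<times> int \<Rightarrow> 'h::comm_ring_1 set) \<Rightarrow> (int \<times> int \<Rightarrow> 'a::ring_1 set) \<Rightarrow> ('h \<Rightarrow> 'a) \<Rightarrow>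
     int \<times> int \<Rightarrow> ('a \<Rightarrow> 'h) \<Rightarrow> bool" where
  "homogeneous_functional HG AG \<iota> d f \<longleftrightarrow>
     (\<forall>\<theta> \<theta>'. f (\<theta> + \<theta>') = f \<theta> + f \<theta>') \<and> (\<forall>h \<theta>. f (\<iota> h * \<theta>) = h * f \<theta>) \<and>
     (\<forall>e. \<forall>\<theta>\<in>AG e. f \<theta> \<in> HG (e - d))"

definition graded_dual ::
    "(int \<times> int \<Rightarrow> 'h::comm_ring_1 set) \<Rightarrow> (int \<times> int \<Rightarrow> 'a::ring_1 set) \<Rightarrow> ('h \<Rightarrow> 'a) \<Rightarrow>
     ('a \<Rightarrow> 'h) set" where
  "graded_dual HG AG \<iota> =
     {f. \<exists>fs. (\<forall>g\<in>set fs. \<exists>d. homogeneous_functional HG AG \<iota> d g) \<and> f = (\<lambda>\<theta>. \<Sum>g\<leftarrow>fs. g \<theta>)}"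

section \<open>The mod 2 motivic Steenrod algebra\<close>

text \<open>
  Data, for a base scheme \<open>S\<close>:
  \<^item> \<open>'o\<close> is the ring of global functions of \<open>S\<close> and \<open>kum\<close> sends a unit to its class in \<open>H\<^sup>1\<^sup>,\<^sup>1\<close>
    (its values on non-units are irrelevant);
  \<^item> \<open>'h\<close>, graded by \<open>HG\<close>, is the bigraded mod 2 motivic cohomology of \<open>S\<close>;
  \<^item> \<open>'a\<close>, graded by \<open>AG\<close>, is the algebra of bistable operations, \<open>\<iota>\<close> its \<open>H\<close>-algebra structure
    (the image of \<open>\<iota>\<close> is not central);
  \<^item> \<open>'d\<close> is the dual, with \<open>pair \<alpha> \<theta>\<close> the value of \<open>\<alpha>\<close> at \<open>\<theta>\<close>, and \<open>t\<close>, \<open>x\<close> are its generators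
    \<open>\<tau>\<^sub>i\<close>, \<open>\<xi>\<^sub>i\<close>, with the convention \<open>x 0 = 1\<close>;
  \<^item> \<open>hat\<close> is the Milnor basis, indexed by \<open>milnor_indices\<close>.
  These are tied together by the structure theorems for the motivic Steenrod algebra.
\<close>

locale motivic_steenrod_algebra =
  hopf_algebroid \<eta>\<^sub>L \<eta>\<^sub>R \<epsilon> \<Delta> antipode
  for \<eta>\<^sub>L \<eta>\<^sub>R :: "'h::comm_ring_1 \<Rightarrow> 'd::comm_ring_1"
    and \<epsilon> :: "'d \<Rightarrow> 'h"
    and \<Delta> :: "'d \<Rightarrow> ('d \<times> 'd) multiset"
    and antipode :: "'d \<Rightarrow> 'd" +
  fixes kum :: "'o::comm_ring_1 \<Rightarrow> 'h"
    and HG :: "int \<times> int \<Rightarrow> 'h set"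
    and \<tau> \<rho> :: 'h
    and AG :: "int \<times> int \<Rightarrow> 'a::ring_1 set"
    and \<iota> :: "'h \<Rightarrow> 'a"
    and Sq :: "nat \<Rightarrow> 'a"
    and pair :: "'d \<Rightarrow> 'a \<Rightarrow> 'h"
    and t x :: "nat \<Rightarrow> 'd"
    and hat :: "milnor_index \<Rightarrow> 'a"
  assumes two_invertible: "(2::'o) dvd 1"
    \<comment> \<open>The motivic cohomology of the base\<close>
    and H_char_2: "(1::'h) + 1 = 0"
    and H_graded: "bigraded_ring HG"
    and tau_generator: "HG (0, 1) = {h * \<tau> | h. h \<in> HG (0, 0)}"
    and kum_degree: "u dvd 1 \<Longrightarrow> kum u \<in> HG (1, 1)"
    and kum_mult: "u dvd 1 \<Longrightarrow> v dvd 1 \<Longrightarrow> kum (u * v) = kum u + kum v"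
    and kum_kernel: "u dvd 1 \<Longrightarrow> kum u = 0 \<longleftrightarrow> (\<exists>v. u = v ^ 2)"
    and rho_def: "\<rho> = kum (- 1)"
    \<comment> \<open>The Steenrod algebra\<close>
    and iota_hom: "unital_ring_hom \<iota>"
    and iota_degree: "h \<in> HG d \<Longrightarrow> \<iota> h \<in> AG d"
    and A_graded: "bigraded_ring AG"
    and Sq_0: "Sq 0 = 1"
    and Sq_degree: "Sq i \<in> AG (int i, int (i div 2))"
    and admissible_basis:
      "module_basis (\<lambda>h \<theta>. \<iota> h * \<theta>) (Collect admissible) (\<lambda>is. prod_list (map Sq is))"
    \<comment> \<open>Its dual\<close>
    and dual: "bij_betw pair UNIV (graded_dual HG AG \<iota>)"
    and pair_add: "pair (\<alpha> + \<beta>) \<theta> = pair \<alpha> \<theta> + pair \<beta> \<theta>"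
    and pair_eta_L: "pair (\<eta>\<^sub>L h * \<alpha>) \<theta> = h * pair \<alpha> \<theta>"
    and pair_eta_R: "pair (\<alpha> * \<eta>\<^sub>R h) \<theta> = pair \<alpha> (\<theta> * \<iota> h)"
    and pair_mult: "pair \<alpha> (\<theta>\<^sub>1 * \<theta>\<^sub>2) = (\<Sum>(\<alpha>\<^sub>1, \<alpha>\<^sub>2)\<in>#\<Delta> \<alpha>. pair \<alpha>\<^sub>1 (\<theta>\<^sub>1 * \<iota> (pair \<alpha>\<^sub>2 \<theta>\<^sub>2)))"
    \<comment> \<open>Presentation and Hopf algebroid structure of the dual\<close>
    and x_0: "x 0 = 1"
    and t_degree: "homogeneous_functional HG AG \<iota> (2 ^ (i + 1) - 1, 2 ^ i - 1) (pair (t i))"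
    and x_degree: "homogeneous_functional HG AG \<iota> (2 ^ (i + 1) - 2, 2 ^ i - 1) (pair (x i))"
    and presentation_surj: "surj (peval \<eta>\<^sub>L (milnor_gen t x))"
    and presentation_kernel:
      "{p. peval \<eta>\<^sub>L (milnor_gen t x) p = 0} = module.span (*) (range (milnor_rel \<tau> \<rho>))"
    and monomial_basis:
      "module_basis (\<lambda>h \<alpha>. \<eta>\<^sub>L h * \<alpha>) milnor_indices (milnor_monomial t x)"
    and eta_R_degree_1_1: "h \<in> HG (1, 1) \<Longrightarrow> \<eta>\<^sub>R h = \<eta>\<^sub>L h"
    and eta_R_tau: "\<eta>\<^sub>R \<tau> = \<eta>\<^sub>L \<tau> + \<eta>\<^sub>L \<rho> * t 0"
    and counit_t: "\<epsilon> (t i) = 0"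
    and counit_x: "i \<ge> 1 \<Longrightarrow> \<epsilon> (x i) = 0"
    and coprod_x: "tensor_eq \<eta>\<^sub>L \<eta>\<^sub>R (\<Delta> (x k)) (\<Sum>i\<le>k. {#(x (k - i) ^ (2 ^ i), x i)#})"
    and coprod_t:
      "tensor_eq \<eta>\<^sub>L \<eta>\<^sub>R (\<Delta> (t k)) ({#(t k, 1)#} + (\<Sum>i\<le>k. {#(x (k - i) ^ (2 ^ i), t i)#}))"
    \<comment> \<open>Milnor basis\<close>
    and milnor_basis: "module_basis (\<lambda>h \<theta>. \<iota> h * \<theta>) milnor_indices hat"
    and milnor_dual: "I \<in> milnor_indices \<Longrightarrow> J \<in> milnor_indices \<Longrightarrow>
          pair (milnor_monomial t x I) (hat J) = (if I = J then 1 else 0)"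
    and Sq_1: "Sq 1 = hat (tau_index 0)"
    and Sq_even: "Sq (2 * m) = hat (xi1_index m)"

end

theory Submission
  imports Defs "HOL-Library.Nat_Bijection"
begin

text \<open>
  Elements of the Steenrod algebra are determined by their values on the monomials \<open>\<tau>(E) \<xi>(R)\<close>, and
  a product is evaluated there through the coproduct. In \<open>Q\<^sub>n \<theta>\<close> the first tensor factor only matters
  modulo the \<open>\<xi>\<^sub>k\<close>, so the coproduct becomes \<open>\<tau>\<^sub>k \<mapsto> \<tau>\<^sub>k \<otimes> 1 + 1 \<otimes> \<tau>\<^sub>k\<close>, \<open>\<xi>\<^sub>k \<mapsto> 1 \<otimes> \<xi>\<^sub>k\<close>, and left
  multiplication by \<open>Q\<^sub>n\<close> is dual to removing \<open>\<tau>\<^sub>n\<close>. In \<open>P\<^sup>m Q\<^sub>n\<close> it is the second factor that is taken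
  modulo the \<open>\<xi>\<^sub>k\<close>; there products of \<open>\<tau>\<^sub>i\<close> add up in binary with one factor \<open>\<rho>\<close> per carry. Only
  powers of \<open>\<rho>\<close> occur as coefficients, on which \<open>\<eta>\<^sub>L\<close> and \<open>\<eta>\<^sub>R\<close> agree. For \<open>m = 2\<^sup>n\<close>, splitting off
  \<open>\<tau>\<^sub>n\<close> from \<open>E\<close> gives
  \<open>P\<^bsup>2^n\<^esup> Q\<^sub>n = Q\<^bsub>n+1\<^esub> + Q\<^sub>n P\<^bsup>2^n\<^esup> + \<rho> Q\<^sub>n P\<^bsup>2^(n-1)\<^esup> Q\<^bsub>n-1\<^esub>\<close>, which is the claim.
\<close>

section \<open>Sums over subsets and binary encodings of finite sets\<close>

lemma sum_Pow_insert:
  fixes f :: "'a set \<Rightarrow> 'b::comm_monoid_add"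
  assumes "finite E" "k \<notin> E"
  shows "(\<Sum>D\<in>Pow (insert k E). f D) = (\<Sum>D\<in>Pow E. f D) + (\<Sum>D\<in>Pow E. f (insert k D))"
proof -
  have inj: "inj_on (insert k) (Pow E)"
    using assms(2) by (auto intro!: inj_onI)
  have "Pow E \<inter> insert k ` Pow E = {}"
    using assms(2) by auto
  then have "(\<Sum>D\<in>Pow (insert k E). f D) = (\<Sum>D\<in>Pow E. f D) + (\<Sum>D\<in>insert k ` Pow E. f D)"
    unfolding Pow_insert using assms(1) by (intro sum.union_disjoint) auto
  then show ?thesis
    by (simp add: sum.reindex[OF inj])
qed

lemma set_encode_singleton: "set_encode {n} = 2 ^ n"
  by (simp add: set_encode_def)

lemma set_encode_eq_power_iff:
  assumes "finite E"
  shows "set_encode E = 2 ^ n \<longleftrightarrow> E = {n}"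
  using set_encode_eq[OF assms, of "{n}"] by (simp add: set_encode_singleton)

lemma set_encode_lessThan: "set_encode {..<n} < 2 ^ n"
  by (induction n) (auto simp: set_encode_def lessThan_Suc)

lemma set_encode_mono: "finite B \<Longrightarrow> A \<subseteq> B \<Longrightarrow> set_encode A \<le> set_encode B"
  unfolding set_encode_def by (intro sum_mono2) auto

section \<open>Balanced biadditive maps\<close>

text \<open>These are the maps that factor through the tensor product formed with the right action
  on the first factor and the left action on the second. Since \<Delta> only picks a representative,
  it is used through them.\<close>

definition balanced_biadditive ::
    "('h::comm_ring_1 \<Rightarrow> 'd::comm_ring_1) \<Rightarrow> ('h \<Rightarrow> 'd) \<Rightarrow> ('d \<Rightarrow> 'd \<Rightarrow> 'v::ab_group_add) \<Rightarrow> bool" where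
  "balanced_biadditive l r \<Psi> \<longleftrightarrow>
     (\<forall>a a' b. \<Psi> (a + a') b = \<Psi> a b + \<Psi> a' b) \<and>
     (\<forall>a b b'. \<Psi> a (b + b') = \<Psi> a b + \<Psi> a b') \<and>
     (\<forall>a b h. \<Psi> (a * r h) b = \<Psi> a (l h * b))"

definition tensor_sum :: "('d \<Rightarrow> 'd \<Rightarrow> 'v::ab_group_add) \<Rightarrow> ('d \<times> 'd) multiset \<Rightarrow> 'v" where
  "tensor_sum \<Psi> u = (\<Sum>(a, b)\<in>#u. \<Psi> a b)"

lemma tensor_sum_simps [simp]:
  "tensor_sum \<Psi> {#} = 0"
  "tensor_sum \<Psi> (u + v) = tensor_sum \<Psi> u + tensor_sum \<Psi> v"
  "tensor_sum \<Psi> (add_mset (a, b) u) = \<Psi> a b + tensor_sum \<Psi> u"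
  by (simp_all add: tensor_sum_def)

lemma tensor_sum_sum: "tensor_sum \<Psi> (\<Sum>i\<in>I. f i) = (\<Sum>i\<in>I. tensor_sum \<Psi> (f i))"
  by (induction I rule: infinite_finite_induct) auto

lemma tensor_sum_add:
  "tensor_sum (\<lambda>a b. \<Psi> a b + \<Phi> a b) u = tensor_sum \<Psi> u + tensor_sum \<Phi> u"
  unfolding tensor_sum_def by (simp add: case_prod_unfold sum_mset.distrib)

lemma tensor_sum_eq_0: "(\<And>a b. \<Psi> a b = 0) \<Longrightarrow> tensor_sum \<Psi> u = 0"
  by (simp add: tensor_sum_def case_prod_unfold)

text \<open>Each generator of the congruence is respected by \<Psi>, so the value depends only on
  the tensor.\<close>

lemma tensor_sum_cong:
  assumes \<Psi>: "balanced_biadditive l r \<Psi>" and "tensor_eq l r u v"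
  shows "tensor_sum \<Psi> u = tensor_sum \<Psi> v"
  using assms(2)
proof induction
  case (te_zero b)
  have "\<Psi> (0 + 0) b = \<Psi> 0 b + \<Psi> 0 b"
    using \<Psi> unfolding balanced_biadditive_def by blast
  then show ?case by simp
qed (use \<Psi> in \<open>auto simp: balanced_biadditive_def\<close>)

lemma tensor_sum_mult:
  "tensor_sum \<Psi> (tensor_mult u v) =
     tensor_sum (\<lambda>a b. tensor_sum (\<lambda>a' b'. \<Psi> (a * a') (b * b')) v) u"
proof -
  have inner: "tensor_sum \<Psi> (\<Sum>(a', b')\<in>#v. {#(a * a', b * b')#}) =
      tensor_sum (\<lambda>a' b'. \<Psi> (a * a') (b * b')) v" for a b
    by (induction v) auto
  show ?thesis
    unfolding tensor_mult_def by (induction u) (auto simp: inner)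
qed

lemma balanced_biadditive_mult:
  assumes "balanced_biadditive l r \<Psi>"
  shows "balanced_biadditive l r (\<lambda>a' b'. \<Psi> (a * a') (b * b'))"
  using assms unfolding balanced_biadditive_def
  by (metis (no_types, lifting) distrib_left mult.assoc mult.left_commute)

section \<open>Coproducts of monomials under balanced maps\<close>

context hopf_algebroid
begin

text \<open>This is \<Psi> applied to the tensor a \<otimes> b times the coproduct of y. The
  accumulators a and b let a monomial be processed one factor at a time.\<close>

definition coprod_sum :: "('d \<Rightarrow> 'd \<Rightarrow> 'v::ab_group_add) \<Rightarrow> 'd \<Rightarrow> 'd \<Rightarrow> 'd \<Rightarrow> 'v" where
  "coprod_sum \<Psi> a b y = tensor_sum (\<lambda>a' b'. \<Psi> (a * a') (b * b')) (\<Delta> y)"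

lemma coprod_sum_one:
  assumes "balanced_biadditive \<eta>\<^sub>L \<eta>\<^sub>R \<Psi>"
  shows "coprod_sum \<Psi> a b 1 = \<Psi> a b"
  unfolding coprod_sum_def
  by (simp add: tensor_sum_cong[OF balanced_biadditive_mult[OF assms] coprod_one])

text \<open>This permits replacing the chosen representative of a coproduct by the explicit formula
  for a generator, as \<open>coprod_sum_mult\<close> does.\<close>

lemma balanced_biadditive_coprod_sum:
  assumes "balanced_biadditive \<eta>\<^sub>L \<eta>\<^sub>R \<Psi>"
  shows "balanced_biadditive \<eta>\<^sub>L \<eta>\<^sub>R (\<lambda>a b. coprod_sum \<Psi> (c * a) (d * b) z)"
proof -
  have *: "\<Psi> (a + a') b = \<Psi> a b + \<Psi> a' b" "\<Psi> a (b + b') = \<Psi> a b + \<Psi> a b'"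
    "\<Psi> (a * \<eta>\<^sub>R h) b = \<Psi> a (\<eta>\<^sub>L h * b)" for a a' b b' h
    using assms unfolding balanced_biadditive_def by blast+
  have "\<Psi> (c * (a * \<eta>\<^sub>R h) * a') (d * b * b') = \<Psi> (c * a * a') (d * (\<eta>\<^sub>L h * b) * b')" for a a' b b' h
    using *(3)[of "c * a * a'" h "d * b * b'"] by (simp add: mult_ac)
  then show ?thesis
    unfolding balanced_biadditive_def coprod_sum_def
    by (simp add: distrib_left distrib_right * tensor_sum_add)
qed

lemma coprod_sum_mult:
  assumes \<Psi>: "balanced_biadditive \<eta>\<^sub>L \<eta>\<^sub>R \<Psi>" and u: "tensor_eq \<eta>\<^sub>L \<eta>\<^sub>R (\<Delta> y) u"
  shows "coprod_sum \<Psi> a b (y * z) = tensor_sum (\<lambda>c d. coprod_sum \<Psi> (a * c) (b * d) z) u"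
proof -
  have "coprod_sum \<Psi> a b (y * z) = tensor_sum (\<lambda>c d. coprod_sum \<Psi> (a * c) (b * d) z) (\<Delta> y)"
    unfolding coprod_sum_def tensor_sum_cong[OF balanced_biadditive_mult[OF \<Psi>] coprod_mult]
      tensor_sum_mult by (simp add: mult.assoc)
  also have "\<dots> = tensor_sum (\<lambda>c d. coprod_sum \<Psi> (a * c) (b * d) z) u"
    by (rule tensor_sum_cong[OF balanced_biadditive_coprod_sum[OF \<Psi>] u])
  finally show ?thesis .
qed

lemma coprod_sum_prod:
  assumes "finite K"
    and step: "\<And>k a b z. k \<in> K \<Longrightarrow> coprod_sum \<Psi> a b (g k * z) = coprod_sum \<Psi> (a * g\<^sub>1 k) (b * g\<^sub>2 k) z"
  shows "coprod_sum \<Psi> a b ((\<Prod>k\<in>K. g k ^ R k) * z) =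
    coprod_sum \<Psi> (a * (\<Prod>k\<in>K. g\<^sub>1 k ^ R k)) (b * (\<Prod>k\<in>K. g\<^sub>2 k ^ R k)) z"
  using assms
proof (induction K arbitrary: a b)
  case (insert k K)
  have pow: "coprod_sum \<Psi> a b (g k ^ n * w) = coprod_sum \<Psi> (a * g\<^sub>1 k ^ n) (b * g\<^sub>2 k ^ n) w" for a b n w
    by (induction n arbitrary: a b) (simp_all add: insert.prems mult.assoc)
  show ?case
    using insert by (simp add: pow mult.assoc)
qed simp

end

section \<open>Evaluation of polynomials\<close>

lemma peval_superset:
  assumes "\<eta> 0 = 0" "finite K" "Poly_Mapping.keys p \<subseteq> K"
  shows "peval \<eta> g p =
    (\<Sum>m\<in>K. \<eta> (Poly_Mapping.lookup p m) * (\<Prod>v\<in>Poly_Mapping.keys m. g v ^ Poly_Mapping.lookup m v))"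
  unfolding peval_def using assms by (intro sum.mono_neutral_left) (auto simp: in_keys_iff)

lemma peval_add:
  assumes "unital_ring_hom \<eta>"
  shows "peval \<eta> g (p + q) = peval \<eta> g p + peval \<eta> g q"
proof -
  have add: "\<eta> (x + y) = \<eta> x + \<eta> y" for x y
    using assms by (simp add: unital_ring_hom_def)
  have 0: "\<eta> 0 = 0"
    using add[of 0 0] by simp
  let ?K = "Poly_Mapping.keys p \<union> Poly_Mapping.keys q"
  have "finite ?K" "Poly_Mapping.keys (p + q) \<subseteq> ?K"
    by (simp, rule keys_add)
  then show ?thesis
    by (simp add: peval_superset[where \<eta> = \<eta> and K = ?K, OF 0] lookup_add add distrib_right sum.distrib)
qed

lemma peval_single:
  assumes "\<eta> 0 = 0"
  shows "peval \<eta> g (Poly_Mapping.single m c) =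
    \<eta> c * (\<Prod>v\<in>Poly_Mapping.keys m. g v ^ Poly_Mapping.lookup m v)"
  using assms by (simp add: peval_def)

lemma pvar_mult_pvar:
  "pvar v * pvar w = Poly_Mapping.single (Poly_Mapping.single v 1 + Poly_Mapping.single w 1) 1"
  by (simp add: pvar_def mult_single)

lemma pconst_mult_single: "pconst c * Poly_Mapping.single m d = Poly_Mapping.single m (c * d)"
  by (simp add: pconst_def mult_single)

lemma keys_add_nat:
  fixes m n :: "'a \<Rightarrow>\<^sub>0 nat"
  shows "Poly_Mapping.keys (m + n) = Poly_Mapping.keys m \<union> Poly_Mapping.keys n"
  by (auto simp: in_keys_iff lookup_add)

lemma peval_milnor_rel:
  assumes hom: "unital_ring_hom \<eta>"
  shows "peval \<eta> (milnor_gen t x) (milnor_rel \<tau> \<rho> i) =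
    t i ^ 2 + \<eta> \<tau> * x (Suc i) + \<eta> \<rho> * (t (Suc i) + t 0 * x (Suc i))"
proof -
  have 1: "\<eta> 1 = 1" and 0: "\<eta> 0 = 0"
    using hom unfolding unital_ring_hom_def by (auto, metis add_cancel_right_right)
  show ?thesis
    unfolding milnor_rel_def power2_eq_square pvar_mult_pvar
    by (simp add: pvar_def distrib_left pconst_mult_single peval_add[OF hom] peval_single[of \<eta>, OF 0]
        keys_add_nat lookup_add 0 1 lookup_single power2_eq_square insert_commute flip: single_add)
qed

section \<open>The coefficients of a product of a power operation and a primitive\<close>

text \<open>Choosing \<xi>_1^(2^(k-1)) \<otimes> \<tau>_(k-1) for every k in D adds this number both
  to the exponent of \<xi>_1 and to the binary weight of the second factor. For k = 0 the
  subtraction truncates, so uses require 0 \<notin> D.\<close>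

definition half_encode :: "nat set \<Rightarrow> nat" where
  "half_encode D = (\<Sum>k\<in>D. 2 ^ (k - 1))"

lemma half_encode_insert: "finite D \<Longrightarrow> k \<notin> D \<Longrightarrow> half_encode (insert k D) = 2 ^ (k - 1) + half_encode D"
  by (simp add: half_encode_def)

lemma half_encode_empty [simp]: "half_encode {} = 0"
  by (simp add: half_encode_def)

lemma set_encode_eq_double_half_encode: "0 \<notin> D \<Longrightarrow> set_encode D = 2 * half_encode D"
  unfolding set_encode_def half_encode_def sum_distrib_left
  by (intro sum.cong refl) (metis Suc_pred' gr0I power_Suc)

definition xi1_exponent :: "nat \<Rightarrow> nat \<Rightarrow> nat" where
  "xi1_exponent m = (\<lambda>_. 0)(1 := m)"

text \<open>The coefficient with which the dual of \<open>\<tau>(E) \<xi>(R)\<close> occurs in \<open>P\<^sup>m Q\<^sub>n\<close>; the factors \<open>\<tau>\<^sub>k\<close> with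
  \<open>k \<in> D\<close> contribute the term \<open>\<xi>\<^sub>1\<^bsup>2^(k-1)\<^esup> \<otimes> \<tau>\<^bsub>k-1\<^esub>\<close> of their coproduct, the others \<open>1 \<otimes> \<tau>\<^sub>k\<close>.\<close>

definition PQ_coeff :: "'h::comm_ring_1 \<Rightarrow> nat \<Rightarrow> nat \<Rightarrow> nat set \<Rightarrow> (nat \<Rightarrow> nat) \<Rightarrow> 'h" where
  "PQ_coeff \<rho> m n E R =
     (\<Sum>D\<in>Pow E. if 0 \<notin> D \<and> R(1 := R 1 + half_encode D) = xi1_exponent m \<and>
          half_encode D + set_encode (E - D) = 2 ^ n then \<rho> ^ (card E - 1) else 0)"

text \<open>The three summands are the coefficients of Q_(n+1), of Q_n P^(2^n) and of \<rho> Q_n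
  P^(2^(n-1)) Q_(n-1). If n \<in> E, the sum is split by whether n \<in> D; otherwise a weight count
  leaves only E = {n+1}.\<close>

lemma PQ_coeff_rec:
  assumes fin: "finite E"
  shows "PQ_coeff \<rho> (2 ^ n) n E R =
    (if E = {Suc n} \<and> R = xi1_exponent 0 then 1 else 0) +
    (if E = {n} \<and> R = xi1_exponent (2 ^ n) then 1 else 0) +
    (if n \<in> E \<and> n > 0 then \<rho> * PQ_coeff \<rho> (2 ^ (n - 1)) (n - 1) (E - {n}) R else 0)"
proof (cases "n \<in> E")
  case True
  define E' where "E' = E - {n}"
  have E: "E = insert n E'" "n \<notin> E'" "finite E'"
    using True fin by (auto simp: E'_def)
  let ?f = "\<lambda>D. if 0 \<notin> D \<and> R(1 := R 1 + half_encode D) = xi1_exponent (2 ^ n) \<and>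
          half_encode D + set_encode (E - D) = 2 ^ n then \<rho> ^ (card E - 1) else 0"
  \<comment> \<open>If n stays outside D, it already supplies the whole weight 2^n, so nothing else
    can be present.\<close>
  have f_keep: "?f D = (if D = {} then if E' = {} \<and> R = xi1_exponent (2 ^ n) then 1 else 0 else 0)"
    if D: "D \<in> Pow E'" for D
  proof -
    have [simp]: "finite D" "n \<notin> D" "finite (E' - D)"
      using D E finite_subset by auto
    have "E - D = insert n (E' - D)"
      using E D by auto
    then have enc: "set_encode (E - D) = 2 ^ n + set_encode (E' - D)"
      using E by (simp add: set_encode_insert)
    have "half_encode D = 0 \<longleftrightarrow> D = {}"
      by (simp add: half_encode_def)
    moreover have "set_encode (E' - D) = 0 \<longleftrightarrow> E' - D = {}"
      by (simp add: set_encode_def subset_iff)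
    ultimately have "half_encode D + set_encode (E - D) = 2 ^ n \<longleftrightarrow> D = {} \<and> E' - D = {}"
      unfolding enc by linarith
    then show ?thesis
      using E by auto
  qed
  have first: "(\<Sum>D\<in>Pow E'. ?f D) = (if E' = {} \<and> R = xi1_exponent (2 ^ n) then 1 else 0)"
  proof -
    have "(\<Sum>D\<in>Pow E'. ?f D) =
        (\<Sum>D\<in>Pow E'. if D = {} then if E' = {} \<and> R = xi1_exponent (2 ^ n) then 1 else 0 else 0)"
      by (intro sum.cong refl f_keep)
    then show ?thesis
      using E(3) by simp
  qed
  \<comment> \<open>Putting n into D uses 2^(n-1) of the \<xi>_1-exponent and of the weight, both
    2^n; what remains is the same problem for n - 1. For n = 0 the condition 0 \<notin> D
    fails.\<close>
  have second: "(\<Sum>D\<in>Pow E'. ?f (insert n D)) =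
      (if n > 0 then \<rho> * PQ_coeff \<rho> (2 ^ (n - 1)) (n - 1) E' R else 0)"
  proof (cases n)
    case (Suc p)
    have f_insert: "?f (insert n D) = \<rho> * (if 0 \<notin> D \<and> R(1 := R 1 + half_encode D) = xi1_exponent (2 ^ p) \<and>
          half_encode D + set_encode (E' - D) = 2 ^ p then \<rho> ^ (card E' - 1) else 0)"
      if D: "D \<in> Pow E'" for D
    proof -
      have D': "finite D" "n \<notin> D"
        using D E finite_subset by auto
      have half: "half_encode (insert n D) = 2 ^ p + half_encode D"
        using D' Suc by (simp add: half_encode_insert)
      have diff: "E - insert n D = E' - D"
        using E by auto
      have R: "R(1 := R 1 + half_encode (insert n D)) = xi1_exponent (2 ^ n) \<longleftrightarrow>
          R(1 := R 1 + half_encode D) = xi1_exponent (2 ^ p)"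
        unfolding half xi1_exponent_def fun_eq_iff by (auto simp: Suc)
      \<comment> \<open>The positive weight forces E' to be nonempty, so the truncated subtraction
        loses nothing and exactly one factor \<rho> splits off.\<close>
      have card: "card E - 1 = Suc (card E' - 1)"
        if "half_encode D + set_encode (E' - D) = 2 ^ p"
      proof -
        have "E' \<noteq> {}"
          using that D by (auto simp: set_encode_def)
        then show ?thesis
          using E by (simp add: card_gt_0_iff)
      qed
      have enc: "half_encode (insert n D) + set_encode (E' - D) = 2 ^ n \<longleftrightarrow>
          half_encode D + set_encode (E' - D) = 2 ^ p"
        unfolding half by (auto simp: Suc)
      have "0 \<notin> insert n D \<longleftrightarrow> 0 \<notin> D"
        using Suc by auto
      then show ?thesis
        unfolding R diff enc using card by simp
    qed
    have "(\<Sum>D\<in>Pow E'. ?f (insert n D)) = \<rho> * PQ_coeff \<rho> (2 ^ p) p E' R"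
      unfolding PQ_coeff_def sum_distrib_left by (intro sum.cong refl f_insert)
    then show ?thesis
      by (simp add: Suc)
  qed simp
  have "PQ_coeff \<rho> (2 ^ n) n E R = (\<Sum>D\<in>Pow E'. ?f D) + (\<Sum>D\<in>Pow E'. ?f (insert n D))"
    unfolding PQ_coeff_def by (subst (1) E(1), rule sum_Pow_insert) (use E in auto)
  moreover have "E = {n} \<longleftrightarrow> E' = {}" "E \<noteq> {Suc n}"
    using E by auto
  ultimately show ?thesis
    unfolding first second E'_def[symmetric] using True by auto
next
  case False
  \<comment> \<open>Elements of D count twice their half weight, so E has weight half_encode D +
    2^n, which lies between 2^n and 2^(n+1). As n \<notin> E, the lower bound forces an element
    above n, and then the upper bound is attained.\<close>
  have *: "E = {Suc n} \<and> D = {Suc n} \<and> R = xi1_exponent 0"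
    if D: "D \<subseteq> E" "0 \<notin> D" and R: "R(1 := R 1 + half_encode D) = xi1_exponent (2 ^ n)"
      and enc: "half_encode D + set_encode (E - D) = 2 ^ n" for D
  proof -
    have [simp]: "finite D"
      using D fin finite_subset by auto
    have "set_encode E = set_encode D + set_encode (E - D)"
      unfolding set_encode_def using fin D by (metis add.commute sum.subset_diff)
    then have encE: "set_encode E = half_encode D + 2 ^ n"
      using enc set_encode_eq_double_half_encode[OF D(2)] by simp
    have R1: "R 1 + half_encode D = 2 ^ n"
      using fun_cong[OF R, of 1] by (simp add: xi1_exponent_def)
    have "\<not> E \<subseteq> {..<n}"
      using set_encode_mono[of "{..<n}" E] set_encode_lessThan[of n] encE by auto
    then obtain k where k: "k \<in> E" "k > n"
      using False by (metis lessThan_iff linorder_neqE_nat subsetI)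
    have "2 ^ Suc n \<le> (2 ^ k :: nat)"
      using k by (intro power_increasing) auto
    also have "\<dots> \<le> set_encode E"
      using set_encode_mono[OF fin, of "{k}"] k by (simp add: set_encode_singleton)
    finally have half: "half_encode D = 2 ^ n"
      using encE R1 by simp
    then have "E = {Suc n}"
      using encE set_encode_eq_power_iff[OF fin, of "Suc n"] by simp
    moreover have "D \<noteq> {}"
      using half by auto
    moreover have "R = xi1_exponent 0"
    proof
      fix i
      show "R i = xi1_exponent 0 i"
        using fun_cong[OF R, of i] R1 half by (cases "i = 1") (auto simp: xi1_exponent_def)
    qed
    ultimately show ?thesis
      using D by auto
  qed
  have "PQ_coeff \<rho> (2 ^ n) n E R =
      (\<Sum>D\<in>Pow E. if D = {Suc n} then if E = {Suc n} \<and> R = xi1_exponent 0 then 1 else 0 else 0)"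
    unfolding PQ_coeff_def
  proof (intro sum.cong refl)
    fix D assume D: "D \<in> Pow E"
    let ?c = "0 \<notin> D \<and> R(1 := R 1 + half_encode D) = xi1_exponent (2 ^ n) \<and>
          half_encode D + set_encode (E - D) = 2 ^ n"
    have iff: "?c \<longleftrightarrow> E = {Suc n} \<and> D = {Suc n} \<and> R = xi1_exponent 0"
    proof
      assume "E = {Suc n} \<and> D = {Suc n} \<and> R = xi1_exponent 0"
      then show ?c
        by (auto simp: half_encode_def xi1_exponent_def)
    qed (use *[of D] D in blast)
    show "(if 0 \<notin> D \<and> R(1 := R 1 + half_encode D) = xi1_exponent (2 ^ n) \<and>
          half_encode D + set_encode (E - D) = 2 ^ n then \<rho> ^ (card E - 1) else 0) =
        (if D = {Suc n} then if E = {Suc n} \<and> R = xi1_exponent 0 then 1 else 0 else 0)"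
      unfolding iff by simp
  qed
  also have "\<dots> = (if E = {Suc n} \<and> R = xi1_exponent 0 then 1 else 0)"
    using fin by (auto simp: sum.delta)
  finally show ?thesis
    using False by auto
qed

section \<open>The Milnor basis\<close>

lemma xi1_exponent_0 [simp]: "xi1_exponent 0 = (\<lambda>_. 0)"
  by (simp add: xi1_exponent_def fun_eq_iff)

definition xi_exponents :: "(nat \<Rightarrow> nat) set" where
  "xi_exponents = {R. finite {i. R i \<noteq> 0} \<and> R 0 = 0}"

lemma xi1_exponent_mem [simp]: "xi1_exponent m \<in> xi_exponents"
  by (simp add: xi_exponents_def xi1_exponent_def)

lemma zero_mem_xi_exponents [simp]: "(\<lambda>_. 0) \<in> xi_exponents"
  by (simp add: xi_exponents_def)

lemma xi_exponents_update [simp]: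
  assumes "R \<in> xi_exponents" "k > 0"
  shows "R(k := j) \<in> xi_exponents"
proof -
  have "{i. (R(k := j)) i \<noteq> 0} \<subseteq> insert k {i. R i \<noteq> 0}"
    by auto
  then have "finite {i. (R(k := j)) i \<noteq> 0}"
    by (rule finite_subset) (use assms in \<open>simp add: xi_exponents_def\<close>)
  then show ?thesis
    using assms unfolding xi_exponents_def by simp
qed

text \<open>A 0/1 sequence is recorded by its support, so that sums over subsets and binary
  encodings apply to it.\<close>

definition index :: "nat set \<Rightarrow> (nat \<Rightarrow> nat) \<Rightarrow> milnor_index" where
  "index E R = (\<lambda>i. if i \<in> E then 1 else 0, R)"

lemma index_eq_iff [simp]: "index E R = index E' R' \<longleftrightarrow> E = E' \<and> R = R'"
proof
  assume eq: "index E R = index E' R'"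
  have "i \<in> E \<longleftrightarrow> i \<in> E'" for i
  proof -
    have "fst (index E R) i = fst (index E' R') i"
      using eq by simp
    then show ?thesis
      by (simp add: index_def split: if_splits)
  qed
  then show "E = E' \<and> R = R'"
    using eq by (auto simp: index_def)
qed simp

lemma milnor_indices_eq: "milnor_indices = {index E R | E R. finite E \<and> R \<in> xi_exponents}"
proof (intro equalityI subsetI)
  fix J assume "J \<in> milnor_indices"
  then obtain E R where J: "J = (E, R)" "finite {i. E i \<noteq> 0}" "\<forall>i. E i \<in> {0, 1}" "R \<in> xi_exponents"
    by (auto simp: milnor_indices_def xi_exponents_def)
  have "E = (\<lambda>i. if i \<in> {i. E i \<noteq> 0} then 1 else 0)"
  proof
    fix i
    show "E i = (if i \<in> {i. E i \<noteq> 0} then 1 else 0)"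
      using J(3)[rule_format, of i] by auto
  qed
  then have "J = index {i. E i \<noteq> 0} R"
    by (simp add: index_def J(1))
  then show "J \<in> {index E R | E R. finite E \<and> R \<in> xi_exponents}"
    using J(2,4) by blast
qed (auto simp: milnor_indices_def xi_exponents_def index_def)

lemma tau_index_eq: "tau_index n = index {n} (\<lambda>_. 0)"
  by (auto simp: tau_index_def index_def)

lemma xi1_index_eq: "xi1_index m = index {} (xi1_exponent m)"
  by (auto simp: xi1_index_def index_def xi1_exponent_def)

definition xi_monomial :: "(nat \<Rightarrow> 'd::comm_ring_1) \<Rightarrow> (nat \<Rightarrow> nat) \<Rightarrow> 'd" where
  "xi_monomial x R = (\<Prod>i | R i \<noteq> 0. x i ^ R i)"

lemma xi_monomial_0 [simp]: "xi_monomial x (\<lambda>_. 0) = 1"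
  by (simp add: xi_monomial_def)

lemma xi_monomial_update:
  assumes "R \<in> xi_exponents"
  shows "xi_monomial x (R(k := R k + j)) = x k ^ j * xi_monomial x R"
proof -
  let ?K = "{i. R i \<noteq> 0} - {k}"
  have fin: "finite ?K"
    using assms by (simp add: xi_exponents_def)
  have *: "xi_monomial x S = x k ^ S k * (\<Prod>i\<in>?K. x i ^ R i)" if "\<And>i. i \<noteq> k \<Longrightarrow> S i = R i" for S
  proof -
    have "{i. S i \<noteq> 0} \<subseteq> insert k ?K"
      using that by auto
    then have "xi_monomial x S = (\<Prod>i\<in>insert k ?K. x i ^ S i)"
      unfolding xi_monomial_def using fin by (intro prod.mono_neutral_left) auto
    also have "\<dots> = x k ^ S k * (\<Prod>i\<in>?K. x i ^ S i)"
      using fin by (subst prod.insert) auto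
    also have "(\<Prod>i\<in>?K. x i ^ S i) = (\<Prod>i\<in>?K. x i ^ R i)"
      using that by (intro prod.cong) auto
    finally show ?thesis .
  qed
  show ?thesis
    using *[of "R(k := R k + j)"] *[of R] by (simp add: power_add mult_ac)
qed

lemma milnor_monomial_index: "milnor_monomial t x (index E R) = (\<Prod>i\<in>E. t i) * xi_monomial x R"
  by (simp add: milnor_monomial_def index_def xi_monomial_def)

section \<open>Pairing monomials with the Milnor basis\<close>

context motivic_steenrod_algebra
begin

lemma eta_L_simps [simp]:
  "\<eta>\<^sub>L 1 = 1" "\<eta>\<^sub>L (a + b) = \<eta>\<^sub>L a + \<eta>\<^sub>L b" "\<eta>\<^sub>L (a * b) = \<eta>\<^sub>L a * \<eta>\<^sub>L b" "\<eta>\<^sub>L 0 = 0" "\<eta>\<^sub>L (a ^ n) = \<eta>\<^sub>L a ^ n"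
proof -
  show *: "\<eta>\<^sub>L 1 = 1" "\<eta>\<^sub>L (a + b) = \<eta>\<^sub>L a + \<eta>\<^sub>L b" "\<eta>\<^sub>L (a * b) = \<eta>\<^sub>L a * \<eta>\<^sub>L b" for a b
    using eta_L_hom by (auto simp: unital_ring_hom_def)
  show "\<eta>\<^sub>L 0 = 0"
    using *(2)[of 0 0] by simp
  show "\<eta>\<^sub>L (a ^ n) = \<eta>\<^sub>L a ^ n"
    by (induction n) (simp_all add: *)
qed

lemma eta_R_simps [simp]:
  "\<eta>\<^sub>R 1 = 1" "\<eta>\<^sub>R (a + b) = \<eta>\<^sub>R a + \<eta>\<^sub>R b" "\<eta>\<^sub>R (a * b) = \<eta>\<^sub>R a * \<eta>\<^sub>R b" "\<eta>\<^sub>R 0 = 0" "\<eta>\<^sub>R (a ^ n) = \<eta>\<^sub>R a ^ n"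
proof -
  show *: "\<eta>\<^sub>R 1 = 1" "\<eta>\<^sub>R (a + b) = \<eta>\<^sub>R a + \<eta>\<^sub>R b" "\<eta>\<^sub>R (a * b) = \<eta>\<^sub>R a * \<eta>\<^sub>R b" for a b
    using eta_R_hom by (auto simp: unital_ring_hom_def)
  show "\<eta>\<^sub>R 0 = 0"
    using *(2)[of 0 0] by simp
  show "\<eta>\<^sub>R (a ^ n) = \<eta>\<^sub>R a ^ n"
    by (induction n) (simp_all add: *)
qed

text \<open>As -1 is a unit, its class lies in bidegree (1,1), where the two units agree.\<close>

lemma eta_R_rho: "\<eta>\<^sub>R \<rho> = \<eta>\<^sub>L \<rho>"
  unfolding rho_def by (intro eta_R_degree_1_1 kum_degree) simp

lemma A_char_2: "- \<theta> = (\<theta>::'a)"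
proof -
  have "\<iota> (1 + 1) = \<iota> 1 + \<iota> 1" "\<iota> (0 + 0) = \<iota> 0 + \<iota> 0" "\<iota> 1 = 1"
    using iota_hom unfolding unital_ring_hom_def by blast+
  then have "(1::'a) + 1 = 0"
    using H_char_2 by simp
  then have "\<theta> + \<theta> = 0"
    by (metis distrib_left mult.right_neutral mult_zero_right)
  then show ?thesis
    by (rule minus_unique)
qed

lemma D_add_eq_0D: "a = b" if "a + b = (0::'d)"
proof -
  have "(1::'d) + 1 = 0"
    using eta_L_simps(2)[of 1 1] H_char_2 by simp
  then have "b + b = 0"
    by (metis distrib_left mult.right_neutral mult_zero_right)
  then show ?thesis
    using that by (metis add_right_cancel)
qed

text \<open>Elements of the dual are finite sums of homogeneous functionals, each of them additive
  and left linear.\<close>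

lemma pair_right:
  "pair \<alpha> (\<theta> + \<theta>') = pair \<alpha> \<theta> + pair \<alpha> \<theta>'"
  "pair \<alpha> (\<iota> h * \<theta>) = h * pair \<alpha> \<theta>"
proof -
  have "pair \<alpha> \<in> graded_dual HG AG \<iota>"
    using dual by (auto simp: bij_betw_def)
  then obtain fs where fs: "\<forall>g\<in>set fs. \<exists>d. homogeneous_functional HG AG \<iota> d g"
    and \<alpha>: "pair \<alpha> = (\<lambda>\<theta>. \<Sum>g\<leftarrow>fs. g \<theta>)"
    by (auto simp: graded_dual_def)
  show "pair \<alpha> (\<theta> + \<theta>') = pair \<alpha> \<theta> + pair \<alpha> \<theta>'"
    unfolding \<alpha> using fs by (induction fs) (auto simp: homogeneous_functional_def algebra_simps)
  show "pair \<alpha> (\<iota> h * \<theta>) = h * pair \<alpha> \<theta>"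
    unfolding \<alpha> using fs by (induction fs) (auto simp: homogeneous_functional_def algebra_simps)
qed

lemma pair_0_right [simp]: "pair \<alpha> 0 = 0"
  using pair_right(1)[of \<alpha> 0 0] by simp

lemma pair_0_left [simp]: "pair 0 \<theta> = 0"
  using pair_add[of 0 0 \<theta>] by simp

lemma pair_diff_right: "pair \<alpha> (\<theta> - \<theta>') = pair \<alpha> \<theta> - pair \<alpha> \<theta>'"
  using pair_right(1)[of \<alpha> "\<theta> - \<theta>'" \<theta>'] by (simp add: algebra_simps)

lemma pair_sum_right: "pair \<alpha> (\<Sum>i\<in>I. f i) = (\<Sum>i\<in>I. pair \<alpha> (f i))"
  by (induction I rule: infinite_finite_induct) (auto simp: pair_right)

lemma pair_monomial:
  assumes "finite E" "R \<in> xi_exponents" "finite E'" "R' \<in> xi_exponents"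
  shows "pair ((\<Prod>i\<in>E. t i) * xi_monomial x R) (hat (index E' R')) = (if E = E' \<and> R = R' then 1 else 0)"
  using assms milnor_dual[of "index E R" "index E' R'"]
  by (auto simp: milnor_indices_eq milnor_monomial_index)

text \<open>Expand the difference in the Milnor basis: pairing with the dual monomial reads off each
  coefficient, so all of them vanish.\<close>

lemma pair_eqI:
  assumes "\<And>E R. finite E \<Longrightarrow> R \<in> xi_exponents \<Longrightarrow>
    pair ((\<Prod>i\<in>E. t i) * xi_monomial x R) \<theta> = pair ((\<Prod>i\<in>E. t i) * xi_monomial x R) \<theta>'"
  shows "\<theta> = \<theta>'"
proof -
  interpret A: module "\<lambda>h \<theta>. \<iota> h * \<theta>"
    using milnor_basis by (simp add: module_basis_def)
  have zero: "pair (milnor_monomial t x J) (\<theta> - \<theta>') = 0" if "J \<in> milnor_indices" for J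
    using that assms by (auto simp: milnor_indices_eq milnor_monomial_index pair_diff_right)
  have "\<theta> - \<theta>' \<in> A.span (hat ` milnor_indices)"
    using milnor_basis by (simp add: module_basis_def)
  then obtain B u where B: "finite B" "B \<subseteq> hat ` milnor_indices" and eq: "\<theta> - \<theta>' = (\<Sum>b\<in>B. \<iota> (u b) * b)"
    by (auto simp: A.span_explicit)
  have "u b = 0" if "b \<in> B" for b
  proof -
    obtain J where J: "J \<in> milnor_indices" "b = hat J"
      using B \<open>b \<in> B\<close> by auto
    have "0 = pair (milnor_monomial t x J) (\<Sum>b\<in>B. \<iota> (u b) * b)"
      using zero[OF J(1)] eq by simp
    also have "\<dots> = (\<Sum>b'\<in>B. u b' * pair (milnor_monomial t x J) b')"
      by (simp add: pair_sum_right pair_right)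
    also have "\<dots> = (\<Sum>b'\<in>B. if b' = b then u b else 0)"
    proof (intro sum.cong refl)
      fix b' assume "b' \<in> B"
      then obtain J' where "J' \<in> milnor_indices" "b' = hat J'"
        using B by auto
      moreover have "inj_on hat milnor_indices"
        using milnor_basis by (simp add: module_basis_def)
      ultimately show "u b' * pair (milnor_monomial t x J) b' = (if b' = b then u b else 0)"
        using J milnor_dual[of J J'] by (auto simp: inj_on_def)
    qed
    also have "\<dots> = u b"
      using B \<open>b \<in> B\<close> by simp
    finally show ?thesis by simp
  qed
  then have "\<theta> - \<theta>' = (\<Sum>b\<in>B. \<iota> 0 * b)"
    unfolding eq by (intro sum.cong) auto
  then show ?thesis
    by simp
qed

text \<open>Multiplying a basis monomial by \<xi>_k gives another basis monomial, with nonzero R, so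
  no multiple of \<xi>_k involves a monomial in the \<tau>_i alone.\<close>

lemma pair_x_mult:
  assumes k: "k > 0" and G: "finite G"
  shows "pair (x k * \<alpha>) (hat (index G (\<lambda>_. 0))) = 0"
proof -
  interpret D: module "\<lambda>h \<alpha>. \<eta>\<^sub>L h * \<alpha>"
    using monomial_basis by (simp add: module_basis_def)
  have "\<alpha> \<in> D.span (milnor_monomial t x ` milnor_indices)"
    using monomial_basis by (simp add: module_basis_def)
  then show ?thesis
  proof (induction rule: D.span_induct_alt)
    case (step h b \<beta>)
    then obtain E R where E: "finite E" "R \<in> xi_exponents" "b = (\<Prod>i\<in>E. t i) * xi_monomial x R"
      by (auto simp: milnor_indices_eq milnor_monomial_index)
    have "x k * (\<eta>\<^sub>L h * b + \<beta>) = \<eta>\<^sub>L h * ((\<Prod>i\<in>E. t i) * xi_monomial x (R(k := R k + 1))) + x k * \<beta>"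
      using E by (subst xi_monomial_update) (auto simp: algebra_simps)
    moreover have "R(k := R k + 1) \<noteq> (\<lambda>_. 0)"
      by (metis add_is_0 fun_upd_same zero_neq_one)
    ultimately show ?case
      using E k G step(2) by (simp add: pair_add pair_eta_L pair_monomial del: fun_upd_apply)
  qed simp
qed

text \<open>The defining relation, solved in characteristic two; the multiples of \<xi>_(i+1) are
  collected so that \<open>pair_x_mult\<close> can discard them.\<close>

lemma t_square: "t i * t i = x (Suc i) * (\<eta>\<^sub>L \<tau> + \<eta>\<^sub>L \<rho> * t 0) + \<eta>\<^sub>L \<rho> * t (Suc i)"
proof -
  interpret P: module "(*) :: 'h milnor_poly \<Rightarrow> _"
    by unfold_locales (auto simp: algebra_simps)
  have "milnor_rel \<tau> \<rho> i \<in> P.span (range (milnor_rel \<tau> \<rho>))"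
    by (intro P.span_base) simp
  then have "peval \<eta>\<^sub>L (milnor_gen t x) (milnor_rel \<tau> \<rho> i) = 0"
    using presentation_kernel by blast
  then have "t i * t i + (x (Suc i) * (\<eta>\<^sub>L \<tau> + \<eta>\<^sub>L \<rho> * t 0) + \<eta>\<^sub>L \<rho> * t (Suc i)) = 0"
    unfolding peval_milnor_rel[OF eta_L_hom] by (simp add: algebra_simps power2_eq_square)
  then show ?thesis
    by (rule D_add_eq_0D)
qed

text \<open>Modulo the ideal of the \<open>\<xi>\<^sub>k\<close> the relations become \<open>\<tau>\<^sub>i\<^sup>2 = \<rho> \<tau>\<^bsub>i+1\<^esub>\<close>, so that a product of
  \<open>\<tau>\<^sub>i\<close> is computed by carrying in binary addition.\<close>

lemma pair_prod_t:
  "pair (\<Prod>i\<in>#M. t i) (hat (tau_index n)) =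
     (if (\<Sum>i\<in>#M. 2 ^ i) = (2::nat) ^ n then \<rho> ^ (size M - 1) else 0)"
proof (induction "size M" arbitrary: M rule: less_induct)
  case less
  show ?case
  proof (cases "\<exists>i N. M = {#i, i#} + N")
    case True
    then obtain i N where M: "M = {#i, i#} + N" by blast
    have "(\<Prod>i\<in>#M. t i) = t i * t i * (\<Prod>i\<in>#N. t i)"
      by (simp add: M mult.assoc)
    also have "\<dots> = x (Suc i) * ((\<eta>\<^sub>L \<tau> + \<eta>\<^sub>L \<rho> * t 0) * (\<Prod>i\<in>#N. t i)) +
        \<eta>\<^sub>L \<rho> * (\<Prod>i\<in>#add_mset (Suc i) N. t i)"
      unfolding t_square by (simp add: distrib_right mult.assoc)
    finally have "pair (\<Prod>i\<in>#M. t i) (hat (tau_index n)) =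
        pair (x (Suc i) * ((\<eta>\<^sub>L \<tau> + \<eta>\<^sub>L \<rho> * t 0) * (\<Prod>i\<in>#N. t i))) (hat (tau_index n)) +
        pair (\<eta>\<^sub>L \<rho> * (\<Prod>i\<in>#add_mset (Suc i) N. t i)) (hat (tau_index n))"
      by (simp only: pair_add)
    also have "\<dots> = \<rho> * pair (\<Prod>i\<in>#add_mset (Suc i) N. t i) (hat (tau_index n))"
      unfolding tau_index_eq by (simp only: pair_eta_L pair_x_mult zero_less_Suc finite.intros add_0)
    \<comment> \<open>A carry keeps the total weight, lowers the size by one and releases one factor
      \<rho>.\<close>
    also have "\<dots> = (if (\<Sum>i\<in>#M. 2 ^ i) = (2::nat) ^ n then \<rho> ^ (size M - 1) else 0)"
      by (subst less) (auto simp: M)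
    finally show ?thesis .
  next
    case False
    \<comment> \<open>Without repetitions M is a set, and by uniqueness of binary expansions its
      weight is 2^n only for {n}, where the exponent of \<rho> is 0.\<close>
    have "count M i \<le> 1" for i
    proof (rule ccontr)
      assume "\<not> count M i \<le> 1"
      then have "{#i, i#} \<subseteq># M"
        by (auto simp: subseteq_mset_def)
      then show False
        using False by (metis subset_mset.add_diff_inverse)
    qed
    then have M: "M = mset_set (set_mset M)"
    proof (intro multiset_eqI)
      fix i
      show "count M i = count (mset_set (set_mset M)) i"
        using \<open>count M i \<le> 1\<close> by (auto simp: count_mset_set' not_in_iff Suc_le_eq intro!: le_antisym)
    qed
    define E where "E = set_mset M"
    have E: "finite E" "M = mset_set E"
      using M by (auto simp: E_def)
    have "pair (\<Prod>i\<in>#M. t i) (hat (tau_index n)) = (if E = {n} then 1 else 0)"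
      using pair_monomial[of E "\<lambda>_. 0" "{n}" "\<lambda>_. 0"] E
      by (simp add: tau_index_eq prod_unfold_prod_mset)
    moreover have "(\<Sum>i\<in>#M. 2 ^ i) = set_encode E"
      by (simp add: E set_encode_def sum_unfold_sum_mset)
    ultimately show ?thesis
      using E by (auto simp: set_encode_eq_power_iff)
  qed
qed

section \<open>Products evaluated through the coproduct\<close>

definition prod_pairing :: "'a \<Rightarrow> 'a \<Rightarrow> 'd \<Rightarrow> 'd \<Rightarrow> 'h" where
  "prod_pairing \<theta>\<^sub>1 \<theta>\<^sub>2 a b = pair (a * \<eta>\<^sub>R (pair b \<theta>\<^sub>2)) \<theta>\<^sub>1"

text \<open>The inner value sits in the first functional through \<open>\<eta>\<^sub>R\<close>, so
  balance reduces to multiplicativity of \<open>\<eta>\<^sub>R\<close>; \<open>pair_eta_R\<close>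
  recovers the form in \<open>pair_mult\<close>.\<close>

lemma balanced_prod_pairing: "balanced_biadditive \<eta>\<^sub>L \<eta>\<^sub>R (prod_pairing \<theta>\<^sub>1 \<theta>\<^sub>2)"
  by (simp add: balanced_biadditive_def prod_pairing_def pair_add pair_eta_L distrib_left distrib_right mult.assoc)

lemma pair_mult_coprod_sum: "pair \<alpha> (\<theta>\<^sub>1 * \<theta>\<^sub>2) = coprod_sum (prod_pairing \<theta>\<^sub>1 \<theta>\<^sub>2) 1 1 \<alpha>"
  by (subst pair_mult) (simp add: coprod_sum_def tensor_sum_def prod_pairing_def pair_eta_R)

lemma coprod_sum_x:
  assumes "balanced_biadditive \<eta>\<^sub>L \<eta>\<^sub>R \<Psi>"
  shows "coprod_sum \<Psi> a b (x k * z) = (\<Sum>i\<le>k. coprod_sum \<Psi> (a * x (k - i) ^ 2 ^ i) (b * x i) z)"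
  by (simp add: coprod_sum_mult[OF assms coprod_x] tensor_sum_sum)

lemma coprod_sum_t:
  assumes "balanced_biadditive \<eta>\<^sub>L \<eta>\<^sub>R \<Psi>"
  shows "coprod_sum \<Psi> a b (t k * z) =
    coprod_sum \<Psi> (a * t k) b z + (\<Sum>i\<le>k. coprod_sum \<Psi> (a * x (k - i) ^ 2 ^ i) (b * t i) z)"
  by (simp add: coprod_sum_mult[OF assms coprod_t] tensor_sum_sum)

text \<open>The value on the second factor enters through \<open>\<eta>\<^sub>R\<close>; the
  hypothesis \<open>central\<close> turns this into \<open>\<eta>\<^sub>L\<close>, after which it
  can be pulled out by left linearity.\<close>

lemma pair_Q_mult:
  assumes E: "finite E" "R \<in> xi_exponents"
    and central: "\<And>E R. finite E \<Longrightarrow> R \<in> xi_exponents \<Longrightarrow>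
      \<eta>\<^sub>R (pair ((\<Prod>i\<in>E. t i) * xi_monomial x R) \<theta>) = \<eta>\<^sub>L (pair ((\<Prod>i\<in>E. t i) * xi_monomial x R) \<theta>)"
  shows "pair ((\<Prod>i\<in>E. t i) * xi_monomial x R) (hat (tau_index n) * \<theta>) =
    (if n \<in> E then pair ((\<Prod>i\<in>E - {n}. t i) * xi_monomial x R) \<theta> else 0)"
proof -
  define \<Psi> where "\<Psi> = prod_pairing (hat (tau_index n)) \<theta>"
  have \<Psi>: "balanced_biadditive \<eta>\<^sub>L \<eta>\<^sub>R \<Psi>"
    unfolding \<Psi>_def by (rule balanced_prod_pairing)
  \<comment> \<open>Since 2^i is positive, a factor \<xi>_j splits off the first tensor factor, on
    which the dual of \<tau>_n vanishes. In both coproducts only i = k then survives from the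
    indexed sum.\<close>
  have kill: "coprod_sum \<Psi> (a * x j ^ 2 ^ i) b z = 0" if "j > 0" for a b z i j
    unfolding coprod_sum_def
  proof (rule tensor_sum_eq_0)
    fix a' b'
    have pow: "x j ^ 2 ^ i = x j * x j ^ (2 ^ i - 1)"
      by (simp flip: power_Suc)
    have "\<Psi> (a * x j ^ 2 ^ i * a') (b * b') =
        pair (x j * (a * x j ^ (2 ^ i - 1) * a' * \<eta>\<^sub>R (pair (b * b') \<theta>))) (hat (tau_index n))"
      unfolding \<Psi>_def prod_pairing_def by (subst pow) (simp add: mult_ac)
    then show "\<Psi> (a * x j ^ 2 ^ i * a') (b * b') = 0"
      using that by (simp only: tau_index_eq pair_x_mult finite.intros)
  qed
  have x_step: "coprod_sum \<Psi> a b (x k * z) = coprod_sum \<Psi> (a * 1) (b * x k) z" for a b k z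
    unfolding coprod_sum_x[OF \<Psi>] using kill
    by (subst sum.remove[of _ k]) (auto simp: x_0)
  have t_step: "coprod_sum \<Psi> a b (t k * z) = coprod_sum \<Psi> (a * t k) b z + coprod_sum \<Psi> a (b * t k) z" for a b k z
    unfolding coprod_sum_t[OF \<Psi>] using kill
    by (subst sum.remove[of _ k]) (auto simp: x_0)
  have xi: "coprod_sum \<Psi> a b (xi_monomial x R) = \<Psi> a (b * xi_monomial x R)" for a b
    unfolding xi_monomial_def
    using coprod_sum_prod[of "{i. R i \<noteq> 0}" \<Psi> x "\<lambda>_. 1" x a b R 1] x_step E
    by (simp add: xi_exponents_def coprod_sum_one[OF \<Psi>])
  \<comment> \<open>G collects the \<tau>_k sent to the first factor; pairing with Q_n will leave
    only G = {n}.\<close>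
  have tau: "coprod_sum \<Psi> a b ((\<Prod>i\<in>E. t i) * z) =
      (\<Sum>G\<in>Pow E. coprod_sum \<Psi> (a * (\<Prod>i\<in>G. t i)) (b * (\<Prod>i\<in>E - G. t i)) z)" for a b z
    using E(1)
  proof (induction E arbitrary: a b)
    case (insert k E)
    have G: "finite G" "k \<notin> G" "finite (E - G)" "insert k E - insert k G = E - G"
      "insert k E - G = insert k (E - G)" if "G \<subseteq> E" for G
      using that insert finite_subset by auto
    show ?case
    proof -
      let ?c = "\<lambda>G. coprod_sum \<Psi> (a * (\<Prod>i\<in>G. t i)) (b * (\<Prod>i\<in>insert k E - G. t i)) z"
      have "(\<Sum>G\<in>Pow E. coprod_sum \<Psi> (a * (\<Prod>i\<in>G. t i)) (b * t k * (\<Prod>i\<in>E - G. t i)) z) = (\<Sum>G\<in>Pow E. ?c G)"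
        using insert.hyps by (intro sum.cong refl) (simp add: G mult.assoc)
      moreover have "(\<Sum>G\<in>Pow E. coprod_sum \<Psi> (a * t k * (\<Prod>i\<in>G. t i)) (b * (\<Prod>i\<in>E - G. t i)) z) = (\<Sum>G\<in>Pow E. ?c (insert k G))"
        using insert.hyps by (intro sum.cong refl) (simp add: G mult.assoc)
      ultimately show ?thesis
        using insert.hyps by (simp add: t_step insert.IH sum_Pow_insert add.commute mult.assoc)
    qed
  qed simp
  have "pair ((\<Prod>i\<in>E. t i) * xi_monomial x R) (hat (tau_index n) * \<theta>) =
      (\<Sum>G\<in>Pow E. \<Psi> (\<Prod>i\<in>G. t i) ((\<Prod>i\<in>E - G. t i) * xi_monomial x R))"
    unfolding pair_mult_coprod_sum \<Psi>_def[symmetric] tau xi by simp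
  also have "\<dots> = (\<Sum>G\<in>Pow E. if G = {n} then pair ((\<Prod>i\<in>E - {n}. t i) * xi_monomial x R) \<theta> else 0)"
  proof (intro sum.cong refl)
    fix G assume "G \<in> Pow E"
    then have G: "finite G" "finite (E - G)"
      using E finite_subset by auto
    have "pair (\<Prod>i\<in>G. t i) (hat (tau_index n)) = (if G = {n} then 1 else 0)"
      using pair_monomial[of G "\<lambda>_. 0" "{n}" "\<lambda>_. 0"] G by (simp add: tau_index_eq)
    then show "\<Psi> (\<Prod>i\<in>G. t i) ((\<Prod>i\<in>E - G. t i) * xi_monomial x R) =
        (if G = {n} then pair ((\<Prod>i\<in>E - {n}. t i) * xi_monomial x R) \<theta> else 0)"
      unfolding \<Psi>_def prod_pairing_def central[OF G(2) E(2)]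
      by (simp add: mult.commute[of _ "\<eta>\<^sub>L _"] pair_eta_L)
  qed
  also have "\<dots> = (if n \<in> E then pair ((\<Prod>i\<in>E - {n}. t i) * xi_monomial x R) \<theta> else 0)"
    using E by simp
  finally show ?thesis .
qed

text \<open>The dual of \<tau>_n makes multiples of \<xi>_j vanish in the second factor, and
  \<open>pair_prod_t\<close> evaluates the \<tau>_i there; the first factor must become exactly
  \<xi>_1^m.\<close>

lemma pair_P_mult_Q:
  assumes E: "finite E" "R \<in> xi_exponents"
  shows "pair ((\<Prod>i\<in>E. t i) * xi_monomial x R) (hat (xi1_index m) * hat (tau_index n)) = PQ_coeff \<rho> m n E R"
proof -
  define \<Psi> where "\<Psi> = prod_pairing (hat (xi1_index m)) (hat (tau_index n))"
  have \<Psi>: "balanced_biadditive \<eta>\<^sub>L \<eta>\<^sub>R \<Psi>"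
    unfolding \<Psi>_def by (rule balanced_prod_pairing)
  have kill: "coprod_sum \<Psi> a (b * x j) z = 0" if "j > 0" for a b z j
    unfolding coprod_sum_def
  proof (rule tensor_sum_eq_0)
    fix a' b'
    have "pair (b * x j * b') (hat (tau_index n)) = pair (x j * (b * b')) (hat (tau_index n))"
      by (simp add: mult_ac)
    also have "\<dots> = 0"
      using that by (simp only: tau_index_eq pair_x_mult finite.intros)
    finally show "\<Psi> (a * a') (b * x j * b') = 0"
      by (simp add: \<Psi>_def prod_pairing_def)
  qed
  have x_step: "coprod_sum \<Psi> a b (x k * z) = coprod_sum \<Psi> (a * x k) (b * 1) z" for a b k z
    unfolding coprod_sum_x[OF \<Psi>] using kill
    by (subst sum.remove[of _ 0]) (auto simp: x_0)
  have xi: "coprod_sum \<Psi> a b (xi_monomial x R * z) = coprod_sum \<Psi> (a * xi_monomial x R) b z" for a b z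
    unfolding xi_monomial_def
    using coprod_sum_prod[of "{i. R i \<noteq> 0}" \<Psi> x x "\<lambda>_. 1" a b R z] x_step E
    by (simp add: xi_exponents_def)
  \<comment> \<open>The summand of \<open>PQ_coeff\<close>, generalized by the multiset M of
    \<tau>_i already moved to the second factor. Repetitions occur in M, as \<tau>_k may contribute
    \<tau>_(k-1) next to an existing one.\<close>
  define f where "f R M E D = (if 0 \<notin> D \<and> R(1 := R 1 + half_encode D) = xi1_exponent m \<and>
      (\<Sum>i\<in>#M. 2 ^ i) + half_encode D + set_encode (E - D) = 2 ^ n then \<rho> ^ (size M + card E - 1) else 0)"
    for R M E D
  have tau: "coprod_sum \<Psi> ((\<Prod>i\<in>G. t i) * xi_monomial x R) (\<Prod>i\<in>#M. t i) (\<Prod>i\<in>E. t i) =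
      (if G = {} then \<Sum>D\<in>Pow E. f R M E D else 0)"
    if "finite G" "G \<inter> E = {}" "R \<in> xi_exponents" for G R M
    using E(1) that
  proof (induction E arbitrary: G R M)
    case empty
    have "\<eta>\<^sub>R (pair (\<Prod>i\<in>#M. t i) (hat (tau_index n))) = \<eta>\<^sub>L (pair (\<Prod>i\<in>#M. t i) (hat (tau_index n)))"
      by (simp add: pair_prod_t eta_R_rho)
    then have "coprod_sum \<Psi> ((\<Prod>i\<in>G. t i) * xi_monomial x R) (\<Prod>i\<in>#M. t i) 1 =
        pair (\<Prod>i\<in>#M. t i) (hat (tau_index n)) *
        pair ((\<Prod>i\<in>G. t i) * xi_monomial x R) (hat (xi1_index m))"
      unfolding coprod_sum_one[OF \<Psi>] unfolding \<Psi>_def prod_pairing_def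
      by (simp add: mult.commute[of _ "\<eta>\<^sub>L _"] pair_eta_L)
    also have "\<dots> = (if G = {} then f R M {} {} else 0)"
      using empty by (simp add: xi1_index_eq pair_monomial pair_prod_t f_def)
    finally show ?case
      by simp
  next
    case (insert k E)
    let ?S = "\<lambda>i. coprod_sum \<Psi> ((\<Prod>i\<in>G. t i) * xi_monomial x R * x (k - i) ^ 2 ^ i) ((\<Prod>i\<in>#M. t i) * t i) (\<Prod>i\<in>E. t i)"
    have disj: "G \<inter> E = {}" "insert k G \<inter> E = {}" "k \<notin> G"
      using insert by auto
    \<comment> \<open>The term \<tau>_k \<otimes> 1 makes G nonempty, and P^m vanishes on monomials
      containing some \<tau>_k.\<close>
    have "coprod_sum \<Psi> ((\<Prod>i\<in>G. t i) * xi_monomial x R * t k) (\<Prod>i\<in>#M. t i) (\<Prod>i\<in>E. t i) =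
        coprod_sum \<Psi> ((\<Prod>i\<in>insert k G. t i) * xi_monomial x R) (\<Prod>i\<in>#M. t i) (\<Prod>i\<in>E. t i)"
      using insert.prems disj by (simp add: mult_ac)
    also have "\<dots> = 0"
      using insert.prems disj by (subst insert.IH) auto
    finally have split: "coprod_sum \<Psi> ((\<Prod>i\<in>G. t i) * xi_monomial x R) (\<Prod>i\<in>#M. t i) (\<Prod>i\<in>insert k E. t i) =
        (\<Sum>i\<le>k. ?S i)"
      using insert.hyps by (simp add: coprod_sum_t[OF \<Psi>])
    have S_less: "?S i = (if G = {} then \<Sum>D\<in>Pow E. f (R(k - i := R (k - i) + 2 ^ i)) (add_mset i M) E D else 0)"
      if "i < k" for i
    proof -
      have "(\<Prod>i\<in>G. t i) * xi_monomial x R * x (k - i) ^ 2 ^ i =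
          (\<Prod>i\<in>G. t i) * xi_monomial x (R(k - i := R (k - i) + 2 ^ i))"
        by (simp only: xi_monomial_update[OF insert.prems(3)] mult_ac)
      moreover have "(\<Prod>i\<in>#M. t i) * t i = (\<Prod>i\<in>#add_mset i M. t i)"
        by (simp add: mult.commute)
      moreover have "R(k - i := R (k - i) + 2 ^ i) \<in> xi_exponents"
        using that by (intro xi_exponents_update insert.prems) simp
      ultimately show ?thesis
        using insert.IH[OF insert.prems(1) disj(1)] by presburger
    qed
    have S_k: "?S k = (if G = {} then \<Sum>D\<in>Pow E. f R (add_mset k M) E D else 0)"
      using insert.IH[of G R "add_mset k M"] insert.prems disj by (simp add: x_0 mult_ac)
    show ?case
    proof (cases "G = {}")
      case False
      then show ?thesis
        unfolding split using S_less S_k by (auto simp: le_less intro!: sum.neutral)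
    next
      case True
      have D: "finite D" "k \<notin> D" "finite (E - D)" "k \<notin> E - D" "insert k E - insert k D = E - D"
        "insert k E - D = insert k (E - D)" if "D \<in> Pow E" for D
        using that insert.hyps finite_subset by auto
      have f_k: "f R (add_mset k M) E D = f R M (insert k E) D" if "D \<in> Pow E" for D
        using D[OF that] insert.hyps by (simp add: f_def set_encode_insert add_ac)
      \<comment> \<open>For i < k - 1 the first factor acquires \<xi>_(k-i) with k - i > 1, which
        P^m excludes. So i = k - 1 accounts for the sets containing k, and i = k for the others; for
        k = 0 the former are ruled out by 0 \<notin> D.\<close>
      have "(\<Sum>i<k. ?S i) = (\<Sum>D\<in>Pow E. f R M (insert k E) (insert k D))"
      proof (cases k)
        case 0
        then show ?thesis by (simp add: f_def)
      next
        case (Suc j)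
        have "?S i = 0" if "i < j" for i
        proof -
          have "f (R(k - i := R (k - i) + 2 ^ i)) (add_mset i M) E D = 0" for D
          proof -
            have "((R(k - i := R (k - i) + 2 ^ i))(1 := v)) (k - i) \<noteq> xi1_exponent m (k - i)" for v
            proof -
              have "k - i \<noteq> 1"
                using that Suc by arith
              then show ?thesis
                by (simp add: xi1_exponent_def)
            qed
            then show ?thesis
              unfolding f_def by metis
          qed
          then show ?thesis
            using S_less[of i] that Suc by simp
        qed
        then have "(\<Sum>i<k. ?S i) = ?S j"
          by (simp add: Suc)
        also have "\<dots> = (\<Sum>D\<in>Pow E. f (R(1 := R 1 + 2 ^ j)) (add_mset j M) E D)"
          using S_less[of j] True Suc by simp
        also have "\<dots> = (\<Sum>D\<in>Pow E. f R M (insert k E) (insert k D))"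
        proof (intro sum.cong refl)
          fix D' assume D': "D' \<in> Pow E"
          show "f (R(1 := R 1 + 2 ^ j)) (add_mset j M) E D' = f R M (insert k E) (insert k D')"
            using D[OF D'] insert.hyps Suc
            by (simp add: f_def half_encode_insert add_ac)
        qed
        finally show ?thesis .
      qed
      moreover have "?S k = (\<Sum>D\<in>Pow E. f R M (insert k E) D)"
        unfolding S_k using True f_k by (auto intro: sum.cong)
      ultimately show ?thesis
        unfolding split lessThan_Suc_atMost[symmetric] sum.lessThan_Suc
        using True insert.hyps by (simp add: sum_Pow_insert add.commute)
    qed
  qed
  have "pair ((\<Prod>i\<in>E. t i) * xi_monomial x R) (hat (xi1_index m) * hat (tau_index n)) =
      coprod_sum \<Psi> 1 1 (xi_monomial x R * (\<Prod>i\<in>E. t i))"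
    by (simp add: pair_mult_coprod_sum \<Psi>_def mult.commute)
  also have "\<dots> = (\<Sum>D\<in>Pow E. f R {#} E D)"
    using tau[of "{}" R "{#}"] E by (simp add: xi)
  also have "\<dots> = PQ_coeff \<rho> m n E R"
    unfolding PQ_coeff_def by (intro sum.cong refl) (auto simp: f_def)
  finally show ?thesis .
qed

section \<open>The recursion for the Milnor primitives\<close>

lemma eta_R_PQ_coeff: "\<eta>\<^sub>R (PQ_coeff \<rho> m n E R) = \<eta>\<^sub>L (PQ_coeff \<rho> m n E R)"
proof -
  have "\<eta>\<^sub>R (\<Sum>D\<in>I. g D) = \<eta>\<^sub>L (\<Sum>D\<in>I. g D)" if "\<And>D. \<eta>\<^sub>R (g D) = \<eta>\<^sub>L (g D)" for I :: "nat set set" and g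
    using that by (induction I rule: infinite_finite_induct) auto
  then show ?thesis
    unfolding PQ_coeff_def by (simp add: eta_R_rho)
qed

text \<open>Compared on all monomials, this is \<open>PQ_coeff_rec\<close> up to signs. The case
  distinction stands for Q_(-1) = 0, because n - 1 truncates to 0 at n = 0.\<close>

lemma Q_Suc:
  "hat (tau_index (Suc n)) =
     hat (tau_index n) * hat (xi1_index (2 ^ n)) - hat (xi1_index (2 ^ n)) * hat (tau_index n) +
     (if n > 0 then \<iota> \<rho> * (hat (tau_index n) * (hat (xi1_index (2 ^ (n - 1))) * hat (tau_index (n - 1)))) else 0)"
  (is "_ = ?Q * ?P - ?P * ?Q + ?T")
proof -
  have "hat (tau_index (Suc n)) + ?Q * ?P + ?T = ?P * ?Q"
  proof (rule pair_eqI)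
    fix E :: "nat set" and R assume E: "finite E" "R \<in> xi_exponents"
    let ?m = "(\<Prod>i\<in>E. t i) * xi_monomial x R"
    have "pair ?m (?Q * ?P) = (if E = {n} \<and> R = xi1_exponent (2 ^ n) then 1 else 0)"
    proof -
      have "pair ?m (?Q * ?P) = (if n \<in> E then pair ((\<Prod>i\<in>E - {n}. t i) * xi_monomial x R) ?P else 0)"
        using E by (rule pair_Q_mult) (simp add: xi1_index_eq pair_monomial)
      also have "\<dots> = (if n \<in> E then if E - {n} = {} \<and> R = xi1_exponent (2 ^ n) then 1 else 0 else 0)"
        using E by (simp add: xi1_index_eq pair_monomial)
      also have "\<dots> = (if E = {n} \<and> R = xi1_exponent (2 ^ n) then 1 else 0)"
        by (cases "E = {n}") auto
      finally show ?thesis .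
    qed
    moreover have "pair ?m ?T =
        (if n \<in> E \<and> n > 0 then \<rho> * PQ_coeff \<rho> (2 ^ (n - 1)) (n - 1) (E - {n}) R else 0)"
    proof -
      \<comment> \<open>The coefficients of P^(2^(n-1)) Q_(n-1) are sums of powers of \<rho>, so
        \<open>pair_Q_mult\<close> applies to this product.\<close>
      have "pair ?m (?Q * (hat (xi1_index (2 ^ (n - 1))) * hat (tau_index (n - 1)))) =
        (if n \<in> E then PQ_coeff \<rho> (2 ^ (n - 1)) (n - 1) (E - {n}) R else 0)"
        using E by (subst pair_Q_mult) (simp_all add: pair_P_mult_Q eta_R_PQ_coeff)
      then show ?thesis
        by (simp add: pair_right)
    qed
    moreover have "pair ?m (hat (tau_index (Suc n))) = (if E = {Suc n} \<and> R = xi1_exponent 0 then 1 else 0)"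
      using E by (auto simp: tau_index_eq pair_monomial)
    ultimately show "pair ?m (hat (tau_index (Suc n)) + ?Q * ?P + ?T) = pair ?m (?P * ?Q)"
      using E by (simp only: pair_right(1) pair_P_mult_Q PQ_coeff_rec)
  qed
  then have "hat (tau_index (Suc n)) = ?P * ?Q - ?Q * ?P - ?T"
    by (simp add: algebra_simps)
  \<comment> \<open>In characteristic two all signs may be changed, which turns the commutator
    around.\<close>
  also have "\<dots> = ?P * ?Q + - (?Q * ?P) + - ?T"
    by simp
  also have "\<dots> = ?Q * ?P + - (?P * ?Q) + ?T"
    unfolding A_char_2 by (simp add: add_ac)
  finally show ?thesis
    by simp
qed

end

theorem corollary4:
  fixes \<eta>\<^sub>L \<eta>\<^sub>R :: "'h::comm_ring_1 \<Rightarrow> 'd::comm_ring_1"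
    and \<epsilon> :: "'d \<Rightarrow> 'h"
    and \<Delta> :: "'d \<Rightarrow> ('d \<times> 'd) multiset"
    and antipode :: "'d \<Rightarrow> 'd"
    and kum :: "'o::comm_ring_1 \<Rightarrow> 'h"
    and HG :: "int \<times> int \<Rightarrow> 'h set"
    and \<tau> \<rho> :: 'h
    and AG :: "int \<times> int \<Rightarrow> 'a::ring_1 set"
    and \<iota> :: "'h \<Rightarrow> 'a"
    and Sq :: "nat \<Rightarrow> 'a"
    and pair :: "'d \<Rightarrow> 'a \<Rightarrow> 'h"
    and t x :: "nat \<Rightarrow> 'd"
    and hat :: "milnor_index \<Rightarrow> 'a"
    and Q :: "int \<Rightarrow> 'a"
  assumes "motivic_steenrod_algebra \<eta>\<^sub>L \<eta>\<^sub>R \<epsilon> \<Delta> antipode kum HG \<tau> \<rho> AG \<iota> Sq pair t x hat"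
  defines "Q \<equiv> milnor_Q hat"
  shows "Q 0 = Sq 1 \<and>
    (\<forall>n::nat. Q (int n + 1) =
       commutator (Q (int n)) (Sq (2 ^ (n + 1))) +
       \<iota> \<rho> * Q (int n) * Sq (2 ^ n) * Q (int n - 1))"
proof -
  interpret motivic_steenrod_algebra \<eta>\<^sub>L \<eta>\<^sub>R \<epsilon> \<Delta> antipode kum HG \<tau> \<rho> AG \<iota> Sq pair t x hat
    by fact
  show ?thesis
  proof (intro conjI allI)
    show "Q 0 = Sq 1"
      using Sq_1 by (simp add: Q_def milnor_Q_def)
  next
    fix n :: nat
    have Q: "Q (int k) = hat (tau_index k)" for k
      by (simp add: Q_def milnor_Q_def)
    have Q_Suc': "Q (int n + 1) = hat (tau_index (Suc n))"
      using Q[of "Suc n"] by (simp add: add.commute)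
    have Sq: "Sq (2 ^ (k + 1)) = hat (xi1_index (2 ^ k))" for k
      using Sq_even[of "2 ^ k"] by simp
    show "Q (int n + 1) = commutator (Q (int n)) (Sq (2 ^ (n + 1))) +
        \<iota> \<rho> * Q (int n) * Sq (2 ^ n) * Q (int n - 1)"
    proof (cases n)
      case 0
      \<comment> \<open>Here the last square is Sq^1, not an even square covered by
        \<open>Sq_even\<close>, but its term vanishes with Q_(-1).\<close>
      have "Q (- 1) = 0"
        by (simp add: Q_def milnor_Q_def)
      then show ?thesis
        unfolding Q_Suc' Q_Suc commutator_def Q Sq using 0 by simp
    next
      case (Suc p)
      have "Q (int n - 1) = hat (tau_index p)"
        using Q[of p] Suc by simp
      moreover have "Sq (2 ^ n) = hat (xi1_index (2 ^ p))"
        using Sq[of p] Suc by simp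
      ultimately show ?thesis
        unfolding Q_Suc' Q_Suc commutator_def Q Sq using Suc by (simp add: mult.assoc)
    qed
  qed
qed

end
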